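(* Let $k\ge1$ and $p_1\ge\dots\ge p_k$ be fixed with $\sum_{i=1}^k p_i=1$. Consider an $n$-set whose elements are independently assigned to class $C_i$ with probability $p_i$, and let $X$ denote the number of queries made by the clique algorithm to recover the resulting partition. Then $\mathbb{E}[X]\sim n\sum_{i=1}^k i\,p_i$ as $n\to\infty$.
   Context: The task: recover an unknown set partition of an $n$-set by queries asking an oracle whether two given elements lie in the same class. The clique algorithm builds the partition incrementally starting from the empty partition: elements are processed one at a time; each new element is compared successively to one element of each block discovered so far, the blocks being visited in decreasing order of their current sizes, until a positive answer occurs (the element is added to that block) or all blocks have been visited (a new block is created containing the element). *)

theory Defs
  imports "HOL-Probability.Probability" "HOL-Library.Landau_Symbols"
begin

text \<open>
  The oracle is a predicate \<open>same\<close> on pairs of elements. The algorithm leaves two choices open: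
  the order in which blocks of equal size are visited, and the element that represents a block
  in a query. They are parameters: \<open>ord\<close> lists the blocks of the current partition in the
  order in which they are visited, and \<open>rep\<close> picks an element of a block.
\<close>

definition valid_order :: "('a set set \<Rightarrow> 'a set list) \<Rightarrow> bool" where
  "valid_order ord \<longleftrightarrow>
     (\<forall>P. finite P \<longrightarrow> distinct (ord P) \<and> set (ord P) = P \<and>
        sorted_wrt (\<lambda>A B. card A \<ge> card B) (ord P))"

definition valid_rep :: "('a set \<Rightarrow> 'a) \<Rightarrow> bool" where
  "valid_rep rep \<longleftrightarrow> (\<forall>B. B \<noteq> {} \<longrightarrow> rep B \<in> B)"

text \<open>The block that answers positively (if any) and the number of queries made.\<close>

fun visit_blocks ::
  "('a \<Rightarrow> 'a \<Rightarrow> bool) \<Rightarrow> ('a set \<Rightarrow> 'a) \<Rightarrow> 'a \<Rightarrow> 'a set list \<Rightarrow> 'a set option \<times> nat" where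
  "visit_blocks same rep x [] = (None, 0)"
| "visit_blocks same rep x (B # Bs) =
     (if same x (rep B) then (Some B, 1)
      else case visit_blocks same rep x Bs of (r, q) \<Rightarrow> (r, Suc q))"

definition clique_step ::
  "('a \<Rightarrow> 'a \<Rightarrow> bool) \<Rightarrow> ('a set set \<Rightarrow> 'a set list) \<Rightarrow> ('a set \<Rightarrow> 'a) \<Rightarrow> 'a \<Rightarrow>
   'a set set \<times> nat \<Rightarrow> 'a set set \<times> nat" where
  "clique_step same ord rep x = (\<lambda>(P, q).
     case visit_blocks same rep x (ord P) of
       (Some B, m) \<Rightarrow> (insert (insert x B) (P - {B}), q + m)
     | (None, m) \<Rightarrow> (insert {x} P, q + m))"

text \<open>The partition produced by processing the elements of a list, and the total number of queries.\<close>

definition clique_algorithm ::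
  "('a \<Rightarrow> 'a \<Rightarrow> bool) \<Rightarrow> ('a set set \<Rightarrow> 'a set list) \<Rightarrow> ('a set \<Rightarrow> 'a) \<Rightarrow> 'a list \<Rightarrow>
   'a set set \<times> nat" where
  "clique_algorithm same ord rep xs = fold (clique_step same ord rep) xs ({}, 0)"

definition clique_queries ::
  "('a \<Rightarrow> 'a \<Rightarrow> bool) \<Rightarrow> ('a set set \<Rightarrow> 'a set list) \<Rightarrow> ('a set \<Rightarrow> 'a) \<Rightarrow> 'a list \<Rightarrow> nat" where
  "clique_queries same ord rep xs = snd (clique_algorithm same ord rep xs)"

text \<open>The law of the class index of one element. If \<open>p\<close> is nonnegative on \<open>{1..k}\<close> with sum
  \<open>1\<close>, index \<open>i\<close> has probability \<open>p i\<close>.\<close>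

definition class_pmf :: "nat \<Rightarrow> (nat \<Rightarrow> real) \<Rightarrow> nat pmf" where
  "class_pmf k p = embed_pmf (\<lambda>i. if i \<in> {1..k} then p i else 0)"

text \<open>Independent class indices for the elements of a finite set \<open>A\<close>. The value \<open>0\<close>, which is
  not a class index, is only the default outside \<open>A\<close>.\<close>

definition assignment_pmf :: "nat \<Rightarrow> (nat \<Rightarrow> real) \<Rightarrow> 'a set \<Rightarrow> ('a \<Rightarrow> nat) pmf" where
  "assignment_pmf k p A = Pi_pmf A 0 (\<lambda>_. class_pmf k p)"

end

theory Submission
  imports Defs "HOL-Real_Asymp.Real_Asymp"
begin

text \<open>
  An element processed after \<open>t\<close> others is independent of the state of the algorithm, in which the
  blocks are sorted by the empirical frequencies \<open>N\<^sub>i / t\<close>. Averaged with these frequencies instead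
  of \<open>p\<close>, the number of queries is the minimum over all orders of the classes, so its expectation
  differs from \<open>\<Sum>i i p\<^sub>i\<close> by at most \<open>2 k \<Sum>i |p\<^sub>i - N\<^sub>i / t|\<close>. The variance of \<open>N\<^sub>i\<close> makes this
  \<open>O(1 / sqrt t)\<close>, and summing over \<open>t < n\<close> leaves an error \<open>O(sqrt n)\<close>. Ties among the \<open>p\<^sub>i\<close> and
  classes of probability \<open>0\<close> need no separate treatment.
\<close>

section \<open>Two elementary inequalities for sums\<close>

text \<open>After cancelling the common part, every value left in \<open>A\<close> is at least every
  value left in \<open>B\<close>, and \<open>A\<close> keeps at least as many terms; the minimum of
  \<open>g\<close> over \<open>A - B\<close> separates the two sums.\<close>

lemma sum_le_sum_dominating:
  fixes g :: "'a \<Rightarrow> real"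
  assumes "finite A" "finite B" "card B \<le> card A"
    and nonneg: "\<And>a. a \<in> A \<Longrightarrow> 0 \<le> g a"
    and dom: "\<And>a b. a \<in> A \<Longrightarrow> b \<in> B - A \<Longrightarrow> g b \<le> g a"
  shows "sum g B \<le> sum g A"
proof -
  have card: "card (B - A) \<le> card (A - B)"
    using assms(1-3) by (metis card_le_sym_Diff)
  have "sum g (B - A) \<le> sum g (A - B)"
  proof (cases "A - B = {}")
    case True
    then have "card (B - A) = 0" using card by (simp only: True card.empty le_zero_eq)
    then have "B - A = {}" using assms(2) by (metis card_0_eq finite_Diff)
    then show ?thesis using True by simp
  next
    case False
    define v where "v = Min (g ` (A - B))"
    have v: "v \<in> g ` (A - B)" "\<And>a. a \<in> A - B \<Longrightarrow> v \<le> g a"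
      using False assms(1) by (auto simp: v_def intro!: Min_in)
    have "sum g (B - A) \<le> real (card (B - A)) * v"
      using v(1) dom by (intro sum_bounded_above) auto
    also have "\<dots> \<le> real (card (A - B)) * v"
      using card v(1) nonneg by (intro mult_right_mono) auto
    also have "\<dots> \<le> sum g (A - B)"
      using v(2) by (intro sum_bounded_below) auto
    finally show ?thesis .
  qed
  moreover have "sum g B = sum g (A \<inter> B) + sum g (B - A)"
    using sum.Int_Diff[OF assms(2), of g A] by (simp add: Int_commute)
  moreover have "sum g A = sum g (A \<inter> B) + sum g (A - B)"
    using sum.Int_Diff[OF assms(1)] .
  ultimately show ?thesis by simp
qed

lemma sum_inverse_sqrt_le: "(\<Sum>t<n. 1 / sqrt (real (Suc t))) \<le> 2 * sqrt (real n)"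
proof (induction n)
  case (Suc n)
  define a b where "a = sqrt (real n)" and "b = sqrt (real (Suc n))"
  have ab: "0 \<le> a" "0 < b" "b\<^sup>2 = a\<^sup>2 + 1"
    by (simp_all add: a_def b_def)
  \<comment> \<open>With \<open>b^2 = a^2 + 1\<close> this square rearranges to the telescoping
    estimate \<open>1 / b <= 2 * (b - a)\<close>.\<close>
  have "0 \<le> (b - a)\<^sup>2" by simp
  then have "1 \<le> 2 * (b - a) * b"
    using ab(3) by (simp add: power2_eq_square algebra_simps)
  then have "1 / b \<le> 2 * (b - a)"
    using ab(2) by (simp add: divide_le_eq)
  then show ?case
    using Suc by (simp add: a_def b_def)
qed simp

section \<open>The state of the algorithm\<close>

text \<open>Indexing by the image of \<open>A\<close> instead of by all values of \<open>c\<close>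
  leaves out empty fibres: a class not yet met has no block.\<close>

definition fibres :: "('a \<Rightarrow> 'b) \<Rightarrow> 'a set \<Rightarrow> 'a set set" where
  "fibres c A = (\<lambda>i. {y \<in> A. c y = i}) ` c ` A"

lemma ord_fibres:
  assumes "valid_order ord" "finite A"
  shows "distinct (ord (fibres c A))" "set (ord (fibres c A)) = fibres c A"
    "sorted_wrt (\<lambda>A B. card A \<ge> card B) (ord (fibres c A))"
proof -
  have "finite (fibres c A)" using assms(2) by (simp add: fibres_def)
  then show "distinct (ord (fibres c A))" "set (ord (fibres c A)) = fibres c A"
    "sorted_wrt (\<lambda>A B. card A \<ge> card B) (ord (fibres c A))"
    using assms(1) unfolding valid_order_def by blast+
qed

lemma rep_fibre:
  assumes "valid_rep rep" "B \<in> fibres c A"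
  shows "rep B \<in> A" "B = {y \<in> A. c y = c (rep B)}"
proof -
  obtain i where i: "B = {y \<in> A. c y = i}" "B \<noteq> {}"
    using assms(2) by (auto simp: fibres_def)
  have "rep B \<in> B"
    using assms(1) i(2) unfolding valid_rep_def by metis
  then show "rep B \<in> A" "B = {y \<in> A. c y = c (rep B)}" using i(1) by auto
qed

lemma visit_blocks_cong:
  "(\<And>B. B \<in> set Bs \<Longrightarrow> same x (rep B) = same' x (rep B)) \<Longrightarrow>
     visit_blocks same rep x Bs = visit_blocks same' rep x Bs"
  by (induction Bs) auto

lemma visit_blocks_None:
  "visit_blocks same rep x Bs = (None, q) \<Longrightarrow> B \<in> set Bs \<Longrightarrow> \<not> same x (rep B)"
  by (induction Bs arbitrary: q) (auto split: if_splits prod.splits)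

lemma visit_blocks_Some:
  "visit_blocks same rep x Bs = (Some B, q) \<Longrightarrow> B \<in> set Bs \<and> same x (rep B)"
  by (induction Bs arbitrary: q) (auto split: if_splits prod.splits)

text \<open>Counting from zero, query \<open>m\<close> takes place exactly when none of the first
  \<open>m\<close> representatives shares the class of \<open>x\<close>. Averaged over that class,
  this count turns into tail sums.\<close>

lemma snd_visit_blocks:
  "snd (visit_blocks (\<lambda>x y. c x = c y) rep x Bs) =
     (\<Sum>m<length Bs. of_bool (c x \<notin> set (take m (map (\<lambda>B. c (rep B)) Bs))))"
proof (induction Bs)
  case (Cons B Bs)
  then show ?case
    by (cases "visit_blocks (\<lambda>x y. c x = c y) rep x Bs")
       (simp add: sum.lessThan_Suc_shift del: sum.lessThan_Suc sum_of_bool_eq)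
qed simp

text \<open>A positive answer identifies the fibre of \<open>c x\<close>, the only one that grows;
  if all answers are negative, that fibre was empty and \<open>{x}\<close> is a new block.\<close>

lemma fst_clique_step:
  assumes "valid_order ord" "valid_rep rep" "finite A"
  shows "fst (clique_step (\<lambda>x y. c x = c y) ord rep x (fibres c A, q)) = fibres c (insert x A)"
proof -
  have ord: "set (ord (fibres c A)) = fibres c A"
    by (rule ord_fibres(2)[OF assms(1,3)])
  obtain r m where v: "visit_blocks (\<lambda>x y. c x = c y) rep x (ord (fibres c A)) = (r, m)"
    by force
  show ?thesis
  proof (cases r)
    case None
    have new: "c x \<notin> c ` A"
    proof
      assume "c x \<in> c ` A"
      define B where "B = {y \<in> A. c y = c x}"
      have B: "B \<in> fibres c A" "B \<noteq> {}"
        using \<open>c x \<in> c ` A\<close> by (auto simp: fibres_def B_def)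
      have "rep B \<in> B" using assms(2) B(2) unfolding valid_rep_def by metis
      then have "c x = c (rep B)" by (simp add: B_def)
      moreover have "c x \<noteq> c (rep B)"
        by (rule visit_blocks_None[OF v[unfolded None]]) (simp only: ord B(1))
      ultimately show False by simp
    qed
    have "fibres c (insert x A) =
        insert {y \<in> insert x A. c y = c x} ((\<lambda>i. {y \<in> insert x A. c y = i}) ` c ` A)"
      by (simp only: fibres_def image_insert)
    also have "{y \<in> insert x A. c y = c x} = {x}" using new by (force simp: image_iff)
    also have "(\<lambda>i. {y \<in> insert x A. c y = i}) ` c ` A = fibres c A"
      unfolding fibres_def using new by (intro image_cong) auto
    finally have "fibres c (insert x A) = insert {x} (fibres c A)" .
    then show ?thesis using v None by (simp add: clique_step_def)
  next
    case (Some B)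
    have B: "B \<in> fibres c A" "c x = c (rep B)"
      using visit_blocks_Some[OF v[unfolded Some]] ord by blast+
    have Beq: "B = {y \<in> A. c y = c x}"
      unfolding B(2) by (rule rep_fibre(2)[OF assms(2) B(1)])
    have cimg: "c ` insert x A = insert (c x) (c ` A - {c x})" by auto
    have "fibres c (insert x A) =
        insert (insert x B) ((\<lambda>i. {y \<in> A. c y = i}) ` (c ` A - {c x}))"
      unfolding fibres_def cimg Beq
      by (subst image_insert, intro arg_cong2[where f = insert] image_cong) auto
    moreover have "(\<lambda>i. {y \<in> A. c y = i}) ` (c ` A - {c x}) = fibres c A - {B}"
    proof -
      \<comment> \<open>Non-empty fibres over distinct indices differ, so dropping the index
        \<open>c x\<close> drops exactly the block \<open>B\<close>.\<close>
      have "inj_on (\<lambda>i. {y \<in> A. c y = i}) (c ` A)"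
        by (rule inj_onI) blast
      moreover have "{c x} \<subseteq> c ` A"
        unfolding B(2) using rep_fibre(1)[OF assms(2) B(1)] by blast
      ultimately show ?thesis
        unfolding fibres_def Beq by (subst inj_on_image_set_diff) auto
    qed
    ultimately show ?thesis using v Some by (simp add: clique_step_def)
  qed
qed

lemma clique_algorithm_snoc:
  "clique_algorithm same ord rep (zs @ [x]) =
     clique_step same ord rep x (clique_algorithm same ord rep zs)"
  by (simp add: clique_algorithm_def)

lemma fst_clique_algorithm:
  assumes "valid_order ord" "valid_rep rep"
  shows "fst (clique_algorithm (\<lambda>x y. c x = c y) ord rep zs) = fibres c (set zs)"
proof (induction zs rule: rev_induct)
  case Nil
  then show ?case by (simp add: clique_algorithm_def fibres_def)
next
  case (snoc x zs)
  then obtain q where "clique_algorithm (\<lambda>x y. c x = c y) ord rep zs = (fibres c (set zs), q)"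
    by (metis prod.collapse)
  then show ?case
    using fst_clique_step[OF assms, of "set zs" c x] by (simp add: clique_algorithm_snoc)
qed

lemma clique_queries_snoc:
  assumes "valid_order ord" "valid_rep rep"
  shows "clique_queries (\<lambda>x y. c x = c y) ord rep (zs @ [x]) =
    clique_queries (\<lambda>x y. c x = c y) ord rep zs +
    snd (visit_blocks (\<lambda>x y. c x = c y) rep x (ord (fibres c (set zs))))"
proof -
  obtain q where "clique_algorithm (\<lambda>x y. c x = c y) ord rep zs = (fibres c (set zs), q)"
    using fst_clique_algorithm[OF assms, of c zs] by (metis prod.collapse)
  moreover obtain r m where "visit_blocks (\<lambda>x y. c x = c y) rep x (ord (fibres c (set zs))) = (r, m)"
    by (rule prod.exhaust)
  ultimately show ?thesis
    by (cases r) (simp_all add: clique_queries_def clique_algorithm_snoc clique_step_def)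
qed

lemma fibres_cong: "(\<And>y. y \<in> A \<Longrightarrow> c y = c' y) \<Longrightarrow> fibres c A = fibres c' A"
  unfolding fibres_def by (intro image_cong) auto

text \<open>A representative lies in its block, so only processed elements are ever compared. Hence
  the class of an unprocessed element may be changed freely.\<close>

lemma clique_queries_cong:
  assumes "valid_order ord" "valid_rep rep"
    and "\<And>y. y \<in> set zs \<Longrightarrow> c y = c' y"
  shows "clique_queries (\<lambda>x y. c x = c y) ord rep zs = clique_queries (\<lambda>x y. c' x = c' y) ord rep zs"
  using assms(3)
proof (induction zs rule: rev_induct)
  case Nil
  then show ?case by (simp add: clique_queries_def clique_algorithm_def)
next
  case (snoc x zs)
  have fib: "fibres c (set zs) = fibres c' (set zs)"
    using snoc.prems by (intro fibres_cong) auto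
  have "set (ord (fibres c' (set zs))) = fibres c' (set zs)"
    by (rule ord_fibres(2)[OF assms(1) finite_set])
  then have "visit_blocks (\<lambda>x y. c x = c y) rep x (ord (fibres c' (set zs))) =
      visit_blocks (\<lambda>x y. c' x = c' y) rep x (ord (fibres c' (set zs)))"
    using snoc.prems rep_fibre(1)[OF assms(2), where c = c' and A = "set zs"] by (intro visit_blocks_cong) auto
  then show ?case
    using snoc fib by (simp add: clique_queries_snoc[OF assms(1,2)])
qed

text \<open>The visiting order as a list of class indices, so that the cost of a step can be
  estimated for lists of numbers.\<close>

definition class_list :: "('a set set \<Rightarrow> 'a set list) \<Rightarrow> ('a set \<Rightarrow> 'a) \<Rightarrow> ('a \<Rightarrow> 'b) \<Rightarrow> 'a set \<Rightarrow> 'b list"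
  where "class_list ord rep c A = map (\<lambda>B. c (rep B)) (ord (fibres c A))"

text \<open>A block is the fibre over the class of its representative, so blocks match indices one
  to one and block sizes become class counts.\<close>

lemma class_list:
  assumes "valid_order ord" "valid_rep rep" "finite A"
  shows "distinct (class_list ord rep c A)" "set (class_list ord rep c A) = c ` A"
    "sorted_wrt (\<lambda>i j. card {y \<in> A. c y = i} \<ge> card {y \<in> A. c y = j}) (class_list ord rep c A)"
proof -
  note ord = ord_fibres[OF assms(1,3), of c]
  have "inj_on (\<lambda>B. c (rep B)) (fibres c A)"
    using rep_fibre(2)[OF assms(2), where c = c and A = A] by (intro inj_onI) metis
  then show "distinct (class_list ord rep c A)"
    using ord by (simp add: class_list_def distinct_map)
  show "set (class_list ord rep c A) = c ` A"
  proof
    show "set (class_list ord rep c A) \<subseteq> c ` A"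
      using ord rep_fibre(1)[OF assms(2), where c = c and A = A] by (auto simp: class_list_def)
    show "c ` A \<subseteq> set (class_list ord rep c A)"
    proof
      fix i assume i: "i \<in> c ` A"
      then have B: "{y \<in> A. c y = i} \<in> fibres c A" (is "?B \<in> _") by (auto simp: fibres_def)
      obtain y where y: "y \<in> ?B" using i by auto
      then have "c y = c (rep ?B)" using rep_fibre(2)[OF assms(2) B] by blast
      then have "c (rep ?B) = i" using y by simp
      then show "i \<in> set (class_list ord rep c A)"
        using B ord(2) by (force simp: class_list_def)
    qed
  qed
  show "sorted_wrt (\<lambda>i j. card {y \<in> A. c y = i} \<ge> card {y \<in> A. c y = j}) (class_list ord rep c A)"
    unfolding class_list_def sorted_wrt_map
    using ord(3)
  proof (rule sorted_wrt_mono_rel[rotated])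
    fix B B' assume "B \<in> set (ord (fibres c A))" "B' \<in> set (ord (fibres c A))" "card B \<ge> card B'"
    then show "card {y \<in> A. c y = c (rep B)} \<ge> card {y \<in> A. c y = c (rep B')}"
      using ord(2) rep_fibre(2)[OF assms(2), where c = c and A = A] by metis
  qed
qed

text \<open>The class \<open>i\<close> of the last element enters only as the index tested in the
  last sum; the list depends on the earlier classes alone. So \<open>i\<close> can be averaged with
  the state fixed.\<close>

lemma clique_queries_fun_upd_snoc:
  assumes "valid_order ord" "valid_rep rep" "x \<notin> set zs"
  shows "clique_queries (\<lambda>u v. (c(x := i)) u = (c(x := i)) v) ord rep (zs @ [x]) =
    clique_queries (\<lambda>u v. c u = c v) ord rep zs +
    (\<Sum>m<length (class_list ord rep c (set zs)). of_bool (i \<notin> set (take m (class_list ord rep c (set zs)))))"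
proof -
  let ?c = "c(x := i)"
  have fib: "fibres ?c (set zs) = fibres c (set zs)"
    using assms(3) by (intro fibres_cong) auto
  have "set (ord (fibres c (set zs))) = fibres c (set zs)"
    by (rule ord_fibres(2)[OF assms(1) finite_set])
  then have "map (\<lambda>B. ?c (rep B)) (ord (fibres c (set zs))) = map (\<lambda>B. c (rep B)) (ord (fibres c (set zs)))"
    using rep_fibre(1)[OF assms(2), where c = c and A = "set zs"] assms(3) by (intro map_cong) auto
  moreover have "clique_queries (\<lambda>u v. ?c u = ?c v) ord rep zs = clique_queries (\<lambda>u v. c u = c v) ord rep zs"
    using assms(3) by (intro clique_queries_cong assms) auto
  ultimately show ?thesis
    unfolding clique_queries_snoc[OF assms(1,2)] snd_visit_blocks class_list_def fib
    by (simp only: length_map fun_upd_same)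
qed

section \<open>The cost of one step\<close>

text \<open>Write \<open>i\<close> as the number of \<open>m\<close> with \<open>m < i\<close> and
  exchange the two sums.\<close>

lemma weighted_sum_eq_tail_sums:
  fixes g :: "nat \<Rightarrow> real"
  shows "(\<Sum>i=1..k. real i * g i) = (\<Sum>m<k. sum g {1..k} - sum g {1..m})"
proof -
  have "(\<Sum>m<k. sum g {1..k} - sum g {1..m}) = (\<Sum>m<k. \<Sum>i=1..k. of_bool (m < i) * g i)"
  proof (rule sum.cong[OF refl])
    fix m assume "m \<in> {..<k}"
    then have "sum g {1..k} = sum g {1..m} + sum g {m<..k}"
      by (subst sum.union_disjoint[symmetric]) (auto intro: sum.cong)
    moreover have "(\<Sum>i=1..k. of_bool (m < i) * g i) = sum g {m<..k}"
      by (intro sum.mono_neutral_cong_right) auto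
    ultimately show "sum g {1..k} - sum g {1..m} = (\<Sum>i=1..k. of_bool (m < i) * g i)" by simp
  qed
  also have "\<dots> = (\<Sum>i=1..k. (\<Sum>m<k. of_bool (m < i)) * g i)"
    by (subst sum.swap) (simp add: sum_distrib_right)
  also have "\<dots> = (\<Sum>i=1..k. real i * g i)"
  proof (rule sum.cong[OF refl])
    fix i assume "i \<in> {1..k}"
    then have "(\<Sum>m<k. of_bool (m < i)) = (\<Sum>m<i. 1::real)"
      by (intro sum.mono_neutral_cong_right) auto
    then show "(\<Sum>m<k. of_bool (m < i)) * g i = real i * g i" by simp
  qed
  finally show ?thesis by simp
qed

lemma abs_sum_diff_le:
  fixes f p :: "'a \<Rightarrow> real"
  assumes "finite B" "A \<subseteq> B"
  shows "\<bar>sum f A - sum p A\<bar> \<le> (\<Sum>i\<in>B. \<bar>p i - f i\<bar>)"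
proof -
  have "\<bar>sum f A - sum p A\<bar> = \<bar>\<Sum>i\<in>A. f i - p i\<bar>" by (simp add: sum_subtractf)
  also have "\<dots> \<le> (\<Sum>i\<in>A. \<bar>f i - p i\<bar>)" by (rule sum_abs)
  also have "\<dots> = (\<Sum>i\<in>A. \<bar>p i - f i\<bar>)" by (simp add: abs_minus_commute)
  also have "\<dots> \<le> (\<Sum>i\<in>B. \<bar>p i - f i\<bar>)" using assms by (intro sum_mono2) auto
  finally show ?thesis .
qed

text \<open>
  If the weights \<open>p\<close> are replaced by \<open>f\<close>, for which the list is greedily sorted, the \<open>m\<close>-th tail
  sums of the cost and of \<open>\<Sum>i i p i\<close> both compare top-\<open>m\<close> sums: those of \<open>f\<close> and those of \<open>p\<close>.
  Since \<open>f\<close> vanishes off the list, classes without a block do not matter.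
\<close>

lemma step_cost_bound:
  fixes p f :: "nat \<Rightarrow> real"
  assumes p: "\<And>i j. 1 \<le> i \<Longrightarrow> i \<le> j \<Longrightarrow> j \<le> k \<Longrightarrow> p j \<le> p i"
    "\<And>i. i \<in> {1..k} \<Longrightarrow> 0 \<le> p i"
    and L: "distinct L" "set L \<subseteq> {1..k}" "sorted_wrt (\<lambda>i j. f i \<ge> f j) L"
    and f: "\<And>i. 0 \<le> f i" "\<And>i. i \<notin> set L \<Longrightarrow> f i = 0" "sum f {1..k} = sum p {1..k}"
  shows "\<bar>(\<Sum>i=1..k. p i * (\<Sum>m<length L. of_bool (i \<notin> set (take m L)))) - (\<Sum>i=1..k. real i * p i)\<bar>
      \<le> 2 * real k * (\<Sum>i=1..k. \<bar>p i - f i\<bar>)"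
proof -
  define d where "d = (\<Sum>i=1..k. \<bar>p i - f i\<bar>)"
  define cost :: "nat \<Rightarrow> real" where "cost i = (\<Sum>m<length L. of_bool (i \<notin> set (take m L)))" for i
  have len: "length L \<le> k"
    using card_mono[OF _ L(2)] distinct_card[OF L(1)] by simp
  have cost: "0 \<le> cost i" "cost i \<le> real k" for i
  proof -
    have "cost i \<le> (\<Sum>m<length L. 1)" unfolding cost_def by (intro sum_mono) auto
    then show "cost i \<le> real k" using len by simp
  qed (simp add: cost_def sum_nonneg)
  \<comment> \<open>Each cost is at most \<open>k\<close>, so exchanging the weights
    \<open>p\<close> for \<open>f\<close> changes the averaged cost by at most
    \<open>k * d\<close>.\<close>
  have "\<bar>(\<Sum>i=1..k. p i * cost i) - (\<Sum>i=1..k. f i * cost i)\<bar> = \<bar>\<Sum>i=1..k. (p i - f i) * cost i\<bar>"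
    by (simp add: sum_subtractf algebra_simps)
  also have "\<dots> \<le> (\<Sum>i=1..k. \<bar>p i - f i\<bar> * real k)"
    using cost by (intro order.trans[OF sum_abs] sum_mono) (auto simp: abs_mult intro!: mult_left_mono)
  finally have 1: "\<bar>(\<Sum>i=1..k. p i * cost i) - (\<Sum>i=1..k. f i * cost i)\<bar> \<le> real k * d"
    by (simp add: d_def sum_distrib_left mult.commute)
  define A where "A m = set (take m L)" for m
  have A: "A m \<subseteq> set L" "A m \<subseteq> {1..k}" "finite (A m)" for m
    using set_take_subset[of m L] L(2) by (auto simp: A_def)
  have "(\<Sum>i=1..k. f i * cost i) = (\<Sum>m<length L. \<Sum>i=1..k. f i * of_bool (i \<notin> A m))"
    unfolding cost_def A_def by (simp only: sum_distrib_left) (rule sum.swap)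
  also have "\<dots> = (\<Sum>m<length L. sum f {1..k} - sum f (A m))"
  proof (rule sum.cong[OF refl])
    fix m
    have "(\<Sum>i=1..k. f i * of_bool (i \<notin> A m)) = sum f ({1..k} - A m)"
      by (intro sum.mono_neutral_cong_right) auto
    then show "(\<Sum>i=1..k. f i * of_bool (i \<notin> A m)) = sum f {1..k} - sum f (A m)"
      using A(2)[of m] by (simp add: sum_diff)
  qed
  \<comment> \<open>Beyond the end of the list the prefix carries all of \<open>f\<close>, so zero
    terms extend the sum to the range \<open>m < k\<close> of the tail sums of
    \<open>p\<close>.\<close>
  also have "\<dots> = (\<Sum>m<k. sum f {1..k} - sum f (A m))"
  proof (rule sum.mono_neutral_left)
    show "\<forall>m\<in>{..<k} - {..<length L}. sum f {1..k} - sum f (A m) = 0"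
    proof
      fix m assume "m \<in> {..<k} - {..<length L}"
      then have "A m = set L" by (simp add: A_def)
      moreover have "sum f {1..k} = sum f (set L)"
        using L(2) f(2) by (intro sum.mono_neutral_right) auto
      ultimately show "sum f {1..k} - sum f (A m) = 0" by simp
    qed
  qed (use len in auto)
  finally have fcost: "(\<Sum>i=1..k. f i * cost i) = (\<Sum>m<k. sum f {1..k} - sum f (A m))" .
  \<comment> \<open>Sandwich: \<open>{1..m}\<close> has the larger sum for \<open>p\<close>, the
    prefix \<open>A m\<close> has it for \<open>f\<close>, and exchanging the weights costs at most
    \<open>d\<close> on either set.\<close>
  have "\<bar>sum f (A m) - sum p {1..m}\<bar> \<le> d" if "m < k" for m
  proof -
    have cardA: "card (A m) = min (length L) m"
      using L(1) by (simp add: A_def distinct_card min.commute)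
    have "sum p (A m) \<le> sum p {1..m}"
      using A that cardA p by (intro sum_le_sum_dominating) (auto simp: subset_eq)
    moreover have "\<bar>sum f (A m) - sum p (A m)\<bar> \<le> d"
      unfolding d_def by (intro abs_sum_diff_le A) auto
    moreover have "sum f {1..m} \<le> sum f (A m)"
    proof (cases "m \<le> length L")
      case True
      have "f b \<le> f a" if a: "a \<in> A m" and b: "b \<notin> A m" for a b
      proof (cases "b \<in> set L")
        case bL: True
        have "b \<in> set (drop m L)"
          using b bL by (metis A_def Un_iff append_take_drop_id set_append)
        moreover have "sorted_wrt (\<lambda>i j. f i \<ge> f j) (take m L @ drop m L)"
          using L(3) by simp
        ultimately show ?thesis
          using a unfolding sorted_wrt_append A_def by blast
      next
        case False
        then show ?thesis using f by simp
      qed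
      then show ?thesis using A cardA True f(1) by (intro sum_le_sum_dominating) auto
    next
      case False
      then have "A m = set L" by (simp add: A_def)
      then have "sum f (A m) = sum f {1..k}"
        using L(2) f(2) by (intro sum.mono_neutral_left) auto
      then show ?thesis using that f(1) by (auto intro!: sum_mono2)
    qed
    moreover have "\<bar>sum f {1..m} - sum p {1..m}\<bar> \<le> d"
      unfolding d_def using that by (intro abs_sum_diff_le) auto
    ultimately show ?thesis by linarith
  qed
  then have "(\<Sum>m<k. \<bar>sum p {1..m} - sum f (A m)\<bar>) \<le> (\<Sum>m<k. d)"
    by (intro sum_mono) (simp add: abs_minus_commute)
  then have "\<bar>\<Sum>m<k. sum p {1..m} - sum f (A m)\<bar> \<le> real k * d"
    by (intro order.trans[OF sum_abs]) simp
  \<comment> \<open>The equal total masses cancel in each tail, leaving only the sums over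
    \<open>{1..m}\<close> and \<open>A m\<close>.\<close>
  moreover have "(\<Sum>i=1..k. f i * cost i) - (\<Sum>i=1..k. real i * p i) =
      (\<Sum>m<k. sum p {1..m} - sum f (A m))"
    unfolding fcost weighted_sum_eq_tail_sums f(3) by (simp add: sum_subtractf)
  ultimately have "\<bar>(\<Sum>i=1..k. f i * cost i) - (\<Sum>i=1..k. real i * p i)\<bar> \<le> real k * d"
    by (simp only:)
  then show ?thesis using 1 unfolding cost_def d_def by linarith
qed

section \<open>Averaging over the assignment\<close>

locale class_law =
  fixes k :: nat and p :: "nat \<Rightarrow> real"
  assumes nonneg: "\<And>i. i \<in> {1..k} \<Longrightarrow> 0 \<le> p i"
    and antimono: "\<And>i j. 1 \<le> i \<Longrightarrow> i \<le> j \<Longrightarrow> j \<le> k \<Longrightarrow> p j \<le> p i"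
    and sum_one: "(\<Sum>i=1..k. p i) = 1"
begin

lemma pmf_class_pmf: "pmf (class_pmf k p) i = (if i \<in> {1..k} then p i else 0)"
  unfolding class_pmf_def
proof (rule pmf_embed_pmf)
  have "(\<integral>\<^sup>+ i. ennreal (if i \<in> {1..k} then p i else 0) \<partial>count_space UNIV) =
      (\<Sum>i=1..k. ennreal (if i \<in> {1..k} then p i else 0))"
    by (rule nn_integral_count_space') auto
  also have "\<dots> = ennreal (\<Sum>i=1..k. p i)"
    by (subst sum_ennreal[symmetric]) (auto simp: nonneg)
  finally show "(\<integral>\<^sup>+ i. ennreal (if i \<in> {1..k} then p i else 0) \<partial>count_space UNIV) = 1"
    using sum_one by simp
qed (use nonneg in auto)

lemma set_class_pmf: "set_pmf (class_pmf k p) \<subseteq> {1..k}"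
  by (auto simp: set_pmf_eq pmf_class_pmf split: if_splits)

lemma set_assignment_pmf:
  assumes "finite A" "c \<in> set_pmf (assignment_pmf k p A)"
  shows "c ` A \<subseteq> {1..k}"
proof -
  have "c \<in> PiE_dflt A 0 (\<lambda>_. set_pmf (class_pmf k p))"
    using assms by (simp add: assignment_pmf_def set_Pi_pmf)
  then show ?thesis using set_class_pmf by (auto simp: PiE_dflt_def)
qed

lemma finite_set_assignment_pmf:
  assumes "finite A"
  shows "finite (set_pmf (assignment_pmf k p A))"
proof -
  have "finite (set_pmf (class_pmf k p))"
    using set_class_pmf finite_atLeastAtMost by (rule finite_subset)
  then show ?thesis
    unfolding assignment_pmf_def set_Pi_pmf[OF assms] using assms by (intro finite_PiE_dflt) simp_all
qed

lemma integrable_assignment_pmf: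
  fixes g :: "_ \<Rightarrow> real"
  shows "finite A \<Longrightarrow> integrable (measure_pmf (assignment_pmf k p A)) g"
  by (intro integrable_measure_pmf_finite finite_set_assignment_pmf)

text \<open>The law on the larger set draws the class of \<open>x\<close> independently of the rest;
  all supports being finite, the average over that class moves inside the expectation.\<close>

lemma expectation_assignment_insert:
  fixes g :: "('a \<Rightarrow> nat) \<Rightarrow> real"
  assumes "finite A" "x \<notin> A"
  shows "measure_pmf.expectation (assignment_pmf k p (insert x A)) g =
    measure_pmf.expectation (assignment_pmf k p A) (\<lambda>c. \<Sum>i=1..k. p i * g (c(x := i)))"
proof -
  let ?M = "assignment_pmf k p A"
  have "assignment_pmf k p (insert x A) =
      class_pmf k p \<bind> (\<lambda>i. map_pmf (\<lambda>c. c(x := i)) ?M)"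
    unfolding assignment_pmf_def Pi_pmf_insert'[OF assms] map_pmf_def ..
  then have "measure_pmf.expectation (assignment_pmf k p (insert x A)) g =
      (\<Sum>i=1..k. pmf (class_pmf k p) i *\<^sub>R measure_pmf.expectation (map_pmf (\<lambda>c. c(x := i)) ?M) g)"
    using finite_set_assignment_pmf[OF assms(1)] set_class_pmf
    by (simp only:) (intro pmf_expectation_bind, auto)
  also have "\<dots> = (\<Sum>i=1..k. measure_pmf.expectation ?M (\<lambda>c. p i * g (c(x := i))))"
    by (intro sum.cong) (auto simp: pmf_class_pmf)
  also have "\<dots> = measure_pmf.expectation ?M (\<lambda>c. \<Sum>i=1..k. p i * g (c(x := i)))"
    by (intro Bochner_Integration.integral_sum[symmetric] integrable_assignment_pmf assms)
  finally show ?thesis .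
qed

section \<open>Variance of the class counts\<close>

text \<open>The centred indicator \<open>of_bool (j = i) - p i\<close> has mean \<open>0\<close> and
  variance \<open>p i * (1 - p i)\<close>, so the cross term with \<open>z\<close> vanishes on
  average.\<close>

lemma second_moment_step:
  assumes "i \<in> {1..k}"
  shows "(\<Sum>j=1..k. p j * (z + (of_bool (j = i) - p i))\<^sup>2) = z\<^sup>2 + p i * (1 - p i)"
proof -
  \<comment> \<open>Only \<open>j = i\<close> needs a correction, namely
    \<open>(w + 1)^2 - w^2 = 2 * w + 1\<close> with \<open>w = z - p i\<close>.\<close>
  have "p j * (z + (of_bool (j = i) - p i))\<^sup>2 =
      p j * (z - p i)\<^sup>2 + (if j = i then p j * (2 * (z - p i) + 1) else 0)" for j
    by (cases "j = i") (simp_all add: power2_eq_square algebra_simps)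
  then have "(\<Sum>j=1..k. p j * (z + (of_bool (j = i) - p i))\<^sup>2) =
      (\<Sum>j=1..k. p j) * (z - p i)\<^sup>2 + (\<Sum>j=1..k. if j = i then p j * (2 * (z - p i) + 1) else 0)"
    by (simp only: sum.distrib sum_distrib_right)
  also have "\<dots> = (z - p i)\<^sup>2 + p i * (2 * (z - p i) + 1)"
    using assms unfolding sum_one by simp
  also have "\<dots> = z\<^sup>2 + p i * (1 - p i)"
    by (simp add: power2_eq_square algebra_simps)
  finally show ?thesis .
qed

text \<open>This is the variance of a binomial count; each inserted element adds one independent
  centred indicator.\<close>

lemma second_moment_count:
  fixes A :: "'a set"
  assumes "finite A" "i \<in> {1..k}"
  shows "measure_pmf.expectation (assignment_pmf k p A)
      (\<lambda>c. (real (card {y \<in> A. c y = i}) - real (card A) * p i)\<^sup>2) = real (card A) * (p i * (1 - p i))"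
  using assms(1)
proof (induction A)
  case empty
  then show ?case by simp
next
  case (insert x A)
  let ?Z = "\<lambda>c. real (card {y \<in> A. c y = i}) - real (card A) * p i"
  have "real (card {y \<in> insert x A. (c(x := j)) y = i}) - real (card (insert x A)) * p i =
      ?Z c + (of_bool (j = i) - p i)" for c j
  proof -
    have "{y \<in> insert x A. (c(x := j)) y = i} =
        (if j = i then insert x {y \<in> A. c y = i} else {y \<in> A. c y = i})"
      using insert.hyps by auto
    then have "real (card {y \<in> insert x A. (c(x := j)) y = i}) =
        real (card {y \<in> A. c y = i}) + of_bool (j = i)"
      using insert.hyps by (simp only:) simp
    moreover have "real (card (insert x A)) = real (card A) + 1"
      using insert.hyps by simp
    ultimately show ?thesis by (simp only:) (simp add: distrib_right)
  qed
  then have "measure_pmf.expectation (assignment_pmf k p (insert x A))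
      (\<lambda>c. (real (card {y \<in> insert x A. c y = i}) - real (card (insert x A)) * p i)\<^sup>2) =
    measure_pmf.expectation (assignment_pmf k p A) (\<lambda>c. (?Z c)\<^sup>2 + p i * (1 - p i))"
    unfolding expectation_assignment_insert[OF insert.hyps]
    by (simp only: second_moment_step[OF assms(2)])
  also have "\<dots> = measure_pmf.expectation (assignment_pmf k p A) (\<lambda>c. (?Z c)\<^sup>2) + p i * (1 - p i)"
    by (subst Bochner_Integration.integral_add) (auto intro!: integrable_assignment_pmf insert.hyps)
  also have "\<dots> = real (card (insert x A)) * (p i * (1 - p i))"
    unfolding insert.IH using insert.hyps by (simp add: distrib_right)
  finally show ?case .
qed

text \<open>The inequality \<open>2 * sqrt t * |z| <= z^2 + t\<close> bounds the mean absolute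
  deviation by the variance. The \<open>Suc\<close> keeps the bound meaningful for empty
  \<open>A\<close>.\<close>

lemma expectation_frequency_deviation:
  fixes A :: "'a set"
  assumes "finite A" "i \<in> {1..k}"
  shows "measure_pmf.expectation (assignment_pmf k p A)
      (\<lambda>c. \<bar>p i - real (card {y \<in> A. c y = i}) / real (card A)\<bar>) \<le> 2 / sqrt (real (Suc (card A)))"
proof -
  have "p i \<le> sum p {1..k}"
    using assms(2) by (rule member_le_sum) (use nonneg in auto)
  then have pi: "0 \<le> p i" "p i \<le> 1"
    unfolding sum_one using nonneg[OF assms(2)] by simp_all
  show ?thesis
  proof (cases "card A = 0")
    \<comment> \<open>Division by zero yields \<open>0\<close>, so the deviation is
      \<open>p i\<close>, at most \<open>1\<close>, against a bound of \<open>2\<close>.\<close>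
    case True
    then show ?thesis using pi by simp
  next
    case False
    define t where "t = real (card A)"
    have t: "1 \<le> t" using False by (simp add: t_def)
    let ?Z = "\<lambda>c. real (card {y \<in> A. c y = i}) - t * p i"
    have "\<bar>p i - real (card {y \<in> A. c y = i}) / t\<bar> \<le> ((?Z c)\<^sup>2 + t) / (2 * t * sqrt t)" for c
    proof -
      have "p i - real (card {y \<in> A. c y = i}) / t = - ?Z c / t"
        using t by (simp add: field_simps)
      then have 1: "\<bar>p i - real (card {y \<in> A. c y = i}) / t\<bar> = \<bar>?Z c\<bar> / t"
        using t by (simp add: abs_div)
      have "0 \<le> (\<bar>?Z c\<bar> - sqrt t)\<^sup>2" by simp
      then have "\<bar>?Z c\<bar> * (2 * sqrt t) \<le> (?Z c)\<^sup>2 + t"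
        using t by (simp add: power2_diff)
      then have "\<bar>?Z c\<bar> \<le> ((?Z c)\<^sup>2 + t) / (2 * sqrt t)"
        using t by (simp add: pos_le_divide_eq)
      then have "\<bar>?Z c\<bar> / t \<le> ((?Z c)\<^sup>2 + t) / (2 * sqrt t) / t"
        using t by (intro divide_right_mono) auto
      then show ?thesis unfolding 1 by (simp add: mult_ac)
    qed
    then have "measure_pmf.expectation (assignment_pmf k p A)
        (\<lambda>c. \<bar>p i - real (card {y \<in> A. c y = i}) / t\<bar>) \<le>
      measure_pmf.expectation (assignment_pmf k p A) (\<lambda>c. ((?Z c)\<^sup>2 + t) / (2 * t * sqrt t))"
      by (intro integral_mono integrable_assignment_pmf assms)
    also have "\<dots> = (t * (p i * (1 - p i)) + t) / (2 * t * sqrt t)"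
      using second_moment_count[OF assms] integrable_assignment_pmf[OF assms(1)]
      by (simp add: t_def)
    also have "\<dots> = (p i * (1 - p i) + 1) / (2 * sqrt t)"
      using t by (simp add: field_simps)
    also have "\<dots> \<le> 2 / (2 * sqrt t)"
      using pi t mult_le_one[of "p i" "1 - p i"] by (intro divide_right_mono) auto
    \<comment> \<open>Since \<open>t >= 1\<close>, \<open>4 * t\<close> is at least
      \<open>t + 1\<close>, which absorbs the shift to \<open>Suc (card A)\<close>.\<close>
    also have "\<dots> = 2 / sqrt (4 * t)"
      using t by (simp add: real_sqrt_mult)
    also have "\<dots> \<le> 2 / sqrt (real (Suc (card A)))"
      using t by (intro divide_left_mono) (auto simp: t_def)
    finally show ?thesis by (simp add: t_def)
  qed
qed

section \<open>Increments of the expected number of queries\<close>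

context
  fixes ord :: "'a set set \<Rightarrow> 'a set list" and rep :: "'a set \<Rightarrow> 'a"
  assumes valid: "valid_order ord" "valid_rep rep"
begin

text \<open>Each list is averaged over the classes of its own elements only, so appending an element
  matches inserting it into the assigned set.\<close>

definition expected_queries :: "'a list \<Rightarrow> real" where
  "expected_queries zs = measure_pmf.expectation (assignment_pmf k p (set zs))
     (\<lambda>c. real (clique_queries (\<lambda>x y. c x = c y) ord rep zs))"

text \<open>The empirical frequencies serve as the weights \<open>f\<close> of
  \<open>step_cost_bound\<close>: visiting blocks by decreasing size lists classes by decreasing
  frequency, and a class without a block has frequency \<open>0\<close>.\<close>

lemma step_cost_frequencies:
  fixes A :: "'a set"
  assumes "finite A" "c ` A \<subseteq> {1..k}"
  defines "L \<equiv> class_list ord rep c A"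
  shows "\<bar>(\<Sum>i=1..k. p i * (\<Sum>m<length L. of_bool (i \<notin> set (take m L)))) - (\<Sum>i=1..k. real i * p i)\<bar>
      \<le> 2 * real k * (\<Sum>i=1..k. \<bar>p i - real (card {y \<in> A. c y = i}) / real (card A)\<bar>)"
proof (cases "A = {}")
  \<comment> \<open>Here the frequencies are all \<open>0\<close> and do not sum to
    \<open>1\<close>. No query is made, and the weighted sum is at most \<open>k\<close>, below the
    bound \<open>2 * k\<close>.\<close>
  case True
  then have "L = []" using class_list(2)[OF valid assms(1), of c] by (simp add: L_def)
  moreover have "(\<Sum>i=1..k. real i * p i) \<le> (\<Sum>i=1..k. real k * p i)"
    using nonneg by (intro sum_mono mult_right_mono) auto
  moreover have "0 \<le> (\<Sum>i=1..k. real i * p i)" using nonneg by (intro sum_nonneg) auto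
  moreover have "(\<Sum>i=1..k. \<bar>p i\<bar>) = 1" using nonneg sum_one by simp
  ultimately show ?thesis using True sum_one by (simp add: sum_distrib_left[symmetric])
next
  case False
  note cl = class_list[OF valid assms(1), of c, folded L_def]
  have pos: "0 < card A" using False assms(1) by (simp add: card_gt_0_iff)
  have "(\<Sum>i=1..k. card {y \<in> A. c y = i}) = card A"
    using sum.group[of A "{1..k}" c "\<lambda>_. 1 :: nat"] assms by simp
  then have "(\<Sum>i=1..k. real (card {y \<in> A. c y = i})) = real (card A)"
    by (metis of_nat_sum)
  then have "(\<Sum>i=1..k. real (card {y \<in> A. c y = i}) / real (card A)) = (\<Sum>i=1..k. p i)"
    using pos by (simp add: sum_divide_distrib[symmetric] sum_one[simplified])
  moreover have "sorted_wrt (\<lambda>i j. real (card {y \<in> A. c y = i}) / real (card A) \<ge>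
      real (card {y \<in> A. c y = j}) / real (card A)) L"
    using cl(3) by (rule sorted_wrt_mono_rel[rotated]) (auto intro!: divide_right_mono)
  moreover have "card {y \<in> A. c y = i} = 0" if "i \<notin> set L" for i
  proof -
    have "{y \<in> A. c y = i} = {}" using that cl(2) by auto
    then show ?thesis by (simp only: card.empty)
  qed
  ultimately show ?thesis
    using cl assms(2) antimono nonneg by (intro step_cost_bound) auto
qed

text \<open>Averaging over the class of \<open>x\<close> leaves the expected cost of one step. The
  constant is \<open>2 * k\<close> from the step bound, times \<open>k\<close> classes with mean
  deviation at most \<open>2 / sqrt (t + 1)\<close>, where \<open>t\<close> is the length of
  \<open>zs\<close>.\<close>

lemma expected_queries_snoc:
  assumes "x \<notin> set zs" "distinct zs"
  shows "\<bar>expected_queries (zs @ [x]) - expected_queries zs - (\<Sum>i=1..k. real i * p i)\<bar>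
    \<le> 4 * (real k)\<^sup>2 / sqrt (real (Suc (length zs)))"
proof -
  let ?A = "set zs" and ?S = "\<Sum>i=1..k. real i * p i"
  let ?M = "assignment_pmf k p ?A"
  define L where "L c = class_list ord rep c ?A" for c :: "'a \<Rightarrow> nat"
  define cost where "cost c i = (\<Sum>m<length (L c). of_bool (i \<notin> set (take m (L c))) :: real)"
    for c :: "'a \<Rightarrow> nat" and i
  let ?q = "\<lambda>c zs. real (clique_queries (\<lambda>x y. c x = c y) ord rep zs)"
  note int = integrable_assignment_pmf[OF finite_set, of zs]
  have upd: "?q (c(x := i)) (zs @ [x]) = ?q c zs + cost c i" for c :: "'a \<Rightarrow> nat" and i
    unfolding clique_queries_fun_upd_snoc[OF valid assms(1)] cost_def L_def by simp
  have step: "(\<Sum>i=1..k. p i * ?q (c(x := i)) (zs @ [x])) =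
      ?q c zs + (\<Sum>i=1..k. p i * cost c i)" for c :: "'a \<Rightarrow> nat"
  proof -
    have "(\<Sum>i=1..k. p i * ?q (c(x := i)) (zs @ [x])) = (\<Sum>i=1..k. p i * ?q c zs + p i * cost c i)"
      unfolding upd by (simp only: distrib_left)
    also have "\<dots> = (\<Sum>i=1..k. p i) * ?q c zs + (\<Sum>i=1..k. p i * cost c i)"
      by (simp only: sum.distrib sum_distrib_right)
    finally show ?thesis unfolding sum_one by simp
  qed
  have "expected_queries (zs @ [x]) =
      measure_pmf.expectation ?M (\<lambda>c. \<Sum>i=1..k. p i * ?q (c(x := i)) (zs @ [x]))"
    unfolding expected_queries_def using expectation_assignment_insert[OF _ assms(1)] by simp
  also have "\<dots> = expected_queries zs + measure_pmf.expectation ?M (\<lambda>c. \<Sum>i=1..k. p i * cost c i)"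
    unfolding step expected_queries_def using int by (rule Bochner_Integration.integral_add) (rule int)
  finally have diff: "expected_queries (zs @ [x]) - expected_queries zs - ?S =
      measure_pmf.expectation ?M (\<lambda>c. (\<Sum>i=1..k. p i * cost c i) - ?S)"
    using int by simp
  have "\<bar>expected_queries (zs @ [x]) - expected_queries zs - ?S\<bar> \<le>
      measure_pmf.expectation ?M (\<lambda>c. \<bar>(\<Sum>i=1..k. p i * cost c i) - ?S\<bar>)"
    unfolding diff by (rule integral_abs_bound)
  \<comment> \<open>The pointwise estimate asks for class indices in \<open>{1..k}\<close>, which is
    known on the support; hence an almost-everywhere comparison.\<close>
  also have "\<dots> \<le> measure_pmf.expectation ?M
      (\<lambda>c. 2 * real k * (\<Sum>i=1..k. \<bar>p i - real (card {y \<in> ?A. c y = i}) / real (card ?A)\<bar>))"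
    unfolding cost_def L_def
    by (intro integral_mono_AE int AE_pmfI step_cost_frequencies set_assignment_pmf finite_set)
  also have "\<dots> = 2 * real k * (\<Sum>i=1..k. measure_pmf.expectation ?M
      (\<lambda>c. \<bar>p i - real (card {y \<in> ?A. c y = i}) / real (card ?A)\<bar>))"
    using int by (subst integral_mult_right_zero, subst Bochner_Integration.integral_sum) auto
  also have "\<dots> \<le> 2 * real k * (\<Sum>i=1..k. 2 / sqrt (real (Suc (card ?A))))"
    by (intro mult_left_mono sum_mono expectation_frequency_deviation) auto
  finally show ?thesis
    using assms(2) by (simp add: distinct_card power2_eq_square)
qed

text \<open>The one-step errors add up over the prefixes of \<open>zs\<close>; summing the inverse
  square roots turns the constant \<open>4\<close> into \<open>8\<close>.\<close>

lemma expected_queries_bound: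
  assumes "distinct zs"
  shows "\<bar>expected_queries zs - real (length zs) * (\<Sum>i=1..k. real i * p i)\<bar>
    \<le> 8 * (real k)\<^sup>2 * sqrt (real (length zs))"
proof -
  have "\<bar>expected_queries zs - real (length zs) * (\<Sum>i=1..k. real i * p i)\<bar>
    \<le> 4 * (real k)\<^sup>2 * (\<Sum>t<length zs. 1 / sqrt (real (Suc t)))"
    using assms
  proof (induction zs rule: rev_induct)
    case Nil
    then show ?case by (simp add: expected_queries_def clique_queries_def clique_algorithm_def)
  next
    case (snoc x zs)
    then show ?case
      using expected_queries_snoc[of x zs] by (simp add: algebra_simps)
  qed
  also have "\<dots> \<le> 4 * (real k)\<^sup>2 * (2 * sqrt (real (length zs)))"
    by (intro mult_left_mono sum_inverse_sqrt_le) auto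
  finally show ?thesis by simp
qed

end

end

section \<open>From the error bound to asymptotic equivalence\<close>

theorem theorem4:
  fixes k :: nat and p :: "nat \<Rightarrow> real"
    and ord :: "nat set set \<Rightarrow> nat set list" and rep :: "nat set \<Rightarrow> nat"
    and xs :: "nat \<Rightarrow> nat list"
  assumes "k \<ge> 1"
    and "\<And>i. i \<in> {1..k} \<Longrightarrow> p i \<ge> 0"
    and "\<And>i j. 1 \<le> i \<Longrightarrow> i \<le> j \<Longrightarrow> j \<le> k \<Longrightarrow> p j \<le> p i"
    and "(\<Sum>i=1..k. p i) = 1"
    and "valid_order ord" and "valid_rep rep"
    and "\<And>n. distinct (xs n) \<and> set (xs n) = {..<n}"
  shows "(\<lambda>n. measure_pmf.expectation (assignment_pmf k p {..<n})
              (\<lambda>c. real (clique_queries (\<lambda>x y. c x = c y) ord rep (xs n))))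
           \<sim>[at_top] (\<lambda>n. real n * (\<Sum>i=1..k. real i * p i))"
proof -
  interpret class_law k p
    using assms(2-4) by unfold_locales
  define S where "S = (\<Sum>i=1..k. real i * p i)"
  define F where "F n = measure_pmf.expectation (assignment_pmf k p {..<n})
      (\<lambda>c. real (clique_queries (\<lambda>x y. c x = c y) ord rep (xs n)))" for n
  \<comment> \<open>Every index is at least \<open>1\<close>, so \<open>S\<close> is at least the
    total mass and \<open>n * S\<close> grows linearly.\<close>
  have "(\<Sum>i=1..k. 1 * p i) \<le> S"
    unfolding S_def using nonneg by (intro sum_mono mult_right_mono) auto
  then have S: "1 \<le> S" using sum_one by simp
  \<comment> \<open>The bound is the same for every tie-breaking, every choice of representatives
    and every processing order.\<close>
  have bound: "\<bar>F n - real n * S\<bar> \<le> 8 * (real k)\<^sup>2 * sqrt (real n)" for n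
  proof -
    have xs: "distinct (xs n)" "set (xs n) = {..<n}" "length (xs n) = n"
      using assms(7)[of n] distinct_card[of "xs n"] by auto
    show ?thesis
      using expected_queries_bound[OF assms(5,6) xs(1)] xs
      by (simp add: expected_queries_def[OF assms(5,6)] F_def S_def)
  qed
  have "(\<lambda>n. F n / (real n * S) - 1) \<longlonglongrightarrow> 0"
  proof (rule Lim_null_comparison)
    show "(\<lambda>n. 8 * (real k)\<^sup>2 * (1 / sqrt (real n))) \<longlonglongrightarrow> 0"
      by real_asymp
    show "\<forall>\<^sub>F n in sequentially. norm (F n / (real n * S) - 1) \<le> 8 * (real k)\<^sup>2 * (1 / sqrt (real n))"
      using eventually_gt_at_top[of 0]
    proof eventually_elim
      case (elim n)
      have "norm (F n / (real n * S) - 1) = \<bar>F n - real n * S\<bar> / (real n * S)"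
        using elim S by (simp add: field_simps abs_div)
      also have "\<dots> \<le> \<bar>F n - real n * S\<bar> / (real n * 1)"
        using elim S by (intro divide_left_mono mult_left_mono) auto
      also have "\<dots> \<le> 8 * (real k)\<^sup>2 * sqrt (real n) / real n"
        using bound[of n] by (simp add: divide_right_mono)
      also have "\<dots> = 8 * (real k)\<^sup>2 * (1 / sqrt (real n))"
        using elim by (simp add: field_simps)
      finally show ?case .
    qed
  qed
  then have "(\<lambda>n. F n / (real n * S)) \<longlonglongrightarrow> 1"
    using LIM_zero_iff by blast
  moreover have "\<forall>\<^sub>F n in sequentially. F n \<noteq> 0 \<or> real n * S \<noteq> 0"
    using eventually_gt_at_top[of 0] by eventually_elim (use S in auto)
  ultimately show ?thesis
    unfolding F_def[symmetric] S_def[symmetric] by (intro asymp_equivI')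
qed

end
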